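(* Suppose $\boldsymbol{u}=(1,3,4,\ldots,n,n+1)$ (a vector of length $n$, with spot $2$ unavailable). If $I=\{i_1,\dots,i_k\}$ with $1\le i_1<\cdots<i_k\le n$ and $c_2(n,I)$ denotes the number of outcomes of $\boldsymbol{u}$-parking functions with lucky set $I$, then $$c_2(n,I)=\sum_{j=1}^{k}c_1\big(n-1,\,I_{(i_j)}\big).$$
   Context: Notation: $[n]=\{1,\dots,n\}$, $\mathbb{N}=\{1,2,\dots\}$. For a weakly increasing vector $\boldsymbol{u}=(u_1,\dots,u_n)$ of positive integers, spot $i\in\mathbb{N}$ on a one-way street has capacity $m_i(\boldsymbol{u})$, the number of times $i$ occurs in $\boldsymbol{u}$. Cars $1,\dots,n$ enter in this order with preferences $\boldsymbol{a}=(a_1,\dots,a_n)\in\mathbb{N}^n$; car $c$ parks in the first spot $j\ge a_c$ in which fewer than $m_j(\boldsymbol{u})$ cars are already parked, and fails to park if there is none. $\boldsymbol{a}$ is a $\boldsymbol{u}$-parking function if all cars park. Its outcome is $B_1B_2\cdots B_M$ with $M=\max(\boldsymbol{u})$, where $B_i$ is the set of cars parked in spot $i$ if $m_i(\boldsymbol{u})>0$, and $B_i=\mathtt{X}$ if $m_i(\boldsymbol{u})=0$. A car is lucky if it parks in its preferred spot; the lucky set of $\boldsymbol{a}$ is the set of its lucky cars. For $I\subseteq[n]$, $c_s(n,I)$ is the number of distinct outcomes of $\boldsymbol{u}$-parking functions with lucky set exactly $I$, where $\boldsymbol{u}=(1,2,\dots,s-1,s+1,\dots,n+1)$ has length $n$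 (there are $n$ cars, and among spots $1,\dots,n+1$ only spot $s$ is unavailable). In particular $c_1(n,I)$ corresponds to $\boldsymbol{u}=(2,3,\dots,n+1)$. By convention $c_1(0,\emptyset)=1$ (the empty outcome). For $j_1<\cdots<j_\ell$ in $[n]$, $$I_{(j_1,\dots,j_\ell)}=\{\,i-|\{j_1,\dots,j_\ell\}\cap[i]|\;:\; i\in I\setminus\{j_1,\dots,j_\ell\}\,\}.$$ *)

theory Defs
  imports Main
begin

text \<open>
  Spots and cars are numbered from 1. Vectors are lists, so the entry belonging to car \<open>c\<close>
  is found at list index \<open>c - 1\<close>.
\<close>

definition capacity :: "nat list \<Rightarrow> nat \<Rightarrow> nat" where
  "capacity u i = count_list u i"

text \<open>
  \<open>ps\<close> lists what happened to the cars that have already entered: \<open>Some j\<close> for a car parked in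
  spot \<open>j\<close>, \<open>None\<close> for a car that failed to park.
\<close>

definition has_room :: "nat list \<Rightarrow> nat option list \<Rightarrow> nat \<Rightarrow> bool" where
  "has_room u ps j \<longleftrightarrow> count_list ps (Some j) < capacity u j"

definition next_spot :: "nat list \<Rightarrow> nat option list \<Rightarrow> nat \<Rightarrow> nat option" where
  "next_spot u ps p =
     (if \<exists>j\<ge>p. has_room u ps j then Some (LEAST j. p \<le> j \<and> has_room u ps j) else None)"

definition parked :: "nat list \<Rightarrow> nat list \<Rightarrow> nat option list" where
  "parked u a = foldl (\<lambda>ps p. ps @ [next_spot u ps p]) [] a"

definition parking_function :: "nat list \<Rightarrow> nat list \<Rightarrow> bool" where
  "parking_function u a \<longleftrightarrow>
     length a = length u \<and> (\<forall>p\<in>set a. 1 \<le> p) \<and> None \<notin> set (parked u a)"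

text \<open>
  An unavailable spot (written \<open>X\<close>) is the entry \<open>None\<close>; a spot of positive capacity holding the
  set \<open>B\<close> of cars is the entry \<open>Some B\<close>. Inserting \<open>0\<close> below makes the empty vector have the empty
  outcome and does not affect the maximum of a nonempty vector.
\<close>

definition outcome :: "nat list \<Rightarrow> nat list \<Rightarrow> nat set option list" where
  "outcome u a =
     map (\<lambda>i. if 0 < capacity u i
              then Some {c \<in> {1..length a}. parked u a ! (c - 1) = Some i}
              else None)
         [1..<Suc (Max (insert 0 (set u)))]"

definition lucky_set :: "nat list \<Rightarrow> nat list \<Rightarrow> nat set" where
  "lucky_set u a = {c \<in> {1..length a}. parked u a ! (c - 1) = Some (a ! (c - 1))}"

text \<open>The vector \<open>(1, \<dots>, s - 1, s + 1, \<dots>, n + 1)\<close>; meant for \<open>1 \<le> s \<le> n + 1\<close>.\<close>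

definition street_without :: "nat \<Rightarrow> nat \<Rightarrow> nat list" where
  "street_without s n = [1..<s] @ [s + 1..<n + 2]"

definition num_outcomes :: "nat \<Rightarrow> nat \<Rightarrow> nat set \<Rightarrow> nat" where
  "num_outcomes s n I =
     card {outcome (street_without s n) a | a.
             parking_function (street_without s n) a \<and> lucky_set (street_without s n) a = I}"

text \<open>
  The set \<open>I\<^bsub>(j\<^sub>1,\<dots>,j\<^sub>l)\<^esub>\<close>, where \<open>J = {j\<^sub>1, \<dots>, j\<^sub>l}\<close>. The subtraction does not truncate,
  since \<open>J \<inter> {1..i}\<close> has at most \<open>i\<close> elements.
\<close>

definition remove_relabel :: "nat set \<Rightarrow> nat set \<Rightarrow> nat set" where
  "remove_relabel J I = (\<lambda>i. i - card (J \<inter> {1..i})) ` (I - J)"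

lemma street_without_wf:
  assumes "1 \<le> s" "s \<le> n + 1"
  shows "length (street_without s n) = n" "sorted (street_without s n)"
    "\<forall>x\<in>set (street_without s n). 1 \<le> x"
  using assms by (auto simp: street_without_def sorted_append)

text \<open>The convention \<open>c\<^sub>1(0, \<emptyset>) = 1\<close> follows from the definitions.\<close>

lemma num_outcomes_1_0: "num_outcomes 1 0 {} = 1"
proof -
  have "{outcome [] a | a. parking_function [] a \<and> lucky_set [] a = {}} = {[]}"
    by (auto simp: parking_function_def parked_def outcome_def lucky_set_def)
  then show ?thesis
    by (simp add: num_outcomes_def street_without_def)
qed

end

theory Submission
  imports Defs
begin

text \<open>
  On the street with spots \<open>1, 3, 4, \<dots>, n + 1\<close>, all \<open>n\<close> spots get filled, and the car \<open>c\<close> in spot 1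
  must prefer spot 1, so it is lucky; it is the first car with that preference. Every later car
  that prefers spot 1 finds it taken and drives past the missing spot 2, so it behaves exactly like
  a car that prefers spot 2: it parks in the same place, and it is unlucky either way. Hence the
  cars other than \<open>c\<close> see only the street \<open>2, 3, \<dots>, n + 1\<close> with spot 2 missing, which is the
  street \<open>1, 2, \<dots>, n\<close> with spot 1 missing, moved by one.

  Deleting \<open>c\<close> and relabelling the remaining cars therefore turns outcomes with lucky set \<open>I\<close> in
  which \<open>c\<close> occupies spot 1 into outcomes on the shorter street with lucky set \<open>I\<^bsub>(c)\<^esub>\<close>, and this is
  a bijection for every \<open>c \<in> I\<close> (\<open>outcomes_prepend_spot\<close>). Its core is the simulation of one parking
  process by the other, \<open>parked_prepend_spot\<close>. The summands of the theorem count the outcomes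
  according to the car in spot 1.

  The argument only uses that the shorter street offers no spot below 2, so the lemmas are stated
  for such a street \<open>w\<close> and for the street that arises from it by a new first spot.
\<close>

section \<open>The parking process\<close>

lemma parked_Nil [simp]: "parked u [] = []"
  by (simp add: parked_def)

lemma parked_snoc: "parked u (a @ [p]) = parked u a @ [next_spot u (parked u a) p]"
  by (simp add: parked_def)

lemma length_parked [simp]: "length (parked u a) = length a"
  by (induction a rule: rev_induct) (auto simp: parked_snoc)

lemma next_spot_SomeD:
  assumes "next_spot u ps p = Some j"
  shows "p \<le> j" "has_room u ps j"
proof -
  have ex: "\<exists>j. p \<le> j \<and> has_room u ps j" and j: "j = (LEAST j. p \<le> j \<and> has_room u ps j)"
    using assms by (auto simp: next_spot_def split: if_splits)
  show "p \<le> j" "has_room u ps j"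
    using LeastI_ex[OF ex] j by auto
qed

lemma next_spot_eq_Some:
  assumes "p \<le> j" "has_room u ps j" "\<And>i. p \<le> i \<Longrightarrow> has_room u ps i \<Longrightarrow> j \<le> i"
  shows "next_spot u ps p = Some j"
  using assms by (auto simp: next_spot_def intro!: Least_equality)

lemma next_spot_eq_None_iff: "next_spot u ps p = None \<longleftrightarrow> (\<forall>j\<ge>p. \<not> has_room u ps j)"
  by (auto simp: next_spot_def)

lemma count_parked_le_capacity: "count_list (parked u a) (Some j) \<le> capacity u j"
proof (induction a rule: rev_induct)
  case (snoc p a)
  then show ?case
    by (auto simp: parked_snoc dest!: next_spot_SomeD(2) simp: has_room_def)
qed simp

lemma in_street_if_parked:
  assumes "Some j \<in> set (parked u a)"
  shows "j \<in> set u"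
proof -
  have "0 < count_list (parked u a) (Some j)"
    using assms by (metis count_list_0_iff gr0I)
  then have "0 < count_list u j"
    using count_parked_le_capacity[of u a j] by (simp add: capacity_def)
  then show ?thesis
    by (metis count_notin less_numeral_extra(3))
qed

lemma length_le_if_all_parked:
  assumes "None \<notin> set (parked u a)"
  shows "length a \<le> length u"
proof -
  have "set (parked u a) \<subseteq> Some ` set u"
    using assms in_street_if_parked by (metis image_eqI not_None_eq subsetI)
  then have "length a = (\<Sum>x\<in>Some ` set u. count_list (parked u a) x)"
    by (simp add: sum_count_set)
  also have "\<dots> = (\<Sum>j\<in>set u. count_list (parked u a) (Some j))"
    by (simp add: sum.reindex)
  also have "\<dots> \<le> (\<Sum>j\<in>set u. count_list u j)"
    using count_parked_le_capacity by (intro sum_mono) (simp add: capacity_def)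
  also have "\<dots> = length u"
    by (simp add: sum_count_set)
  finally show ?thesis .
qed

section \<open>A street with a new first spot\<close>

definition prepend_spot :: "nat list \<Rightarrow> nat list" where
  "prepend_spot w = 1 # map Suc w"

text \<open>
  A car that prefers spot 1 of the longer street but has to drive on is treated on the shorter
  street like one that prefers the next spot, whose number there is 1.
\<close>

definition shift_pref :: "nat \<Rightarrow> nat" where
  "shift_pref p = max 1 (p - 1)"

lemma capacity_prepend_spot_Suc: "1 \<le> j \<Longrightarrow> capacity (prepend_spot w) (Suc j) = capacity w j"
  by (simp add: capacity_def prepend_spot_def count_list_map_conv inj_on_def)

lemma capacity_prepend_spot_1:
  assumes "0 \<notin> set w"
  shows "capacity (prepend_spot w) 1 = 1"
  using assms by (simp add: capacity_def prepend_spot_def count_list_0_iff image_iff)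

text \<open>
  The two streets offer the same free spots, up to the shift, to a car that does not take spot 1.
\<close>

lemma next_spot_prepend_spot:
  assumes cnt: "\<And>j. 1 \<le> j \<Longrightarrow> count_list ps (Some (Suc j)) = count_list qs (Some j)"
    and p: "1 \<le> p" "p = 1 \<Longrightarrow> \<not> has_room (prepend_spot w) ps 1"
  shows "next_spot (prepend_spot w) ps p = map_option Suc (next_spot w qs (shift_pref p))"
proof -
  have room: "has_room (prepend_spot w) ps (Suc j) \<longleftrightarrow> has_room w qs j" if "1 \<le> j" for j
    using that by (simp add: has_room_def capacity_prepend_spot_Suc cnt)
  have dom: "2 \<le> j" if "p \<le> j" "has_room (prepend_spot w) ps j" for j
    using that p by (cases "j = 1") auto
  show ?thesis
  proof (cases "next_spot w qs (shift_pref p)")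
    case None
    have "\<not> has_room (prepend_spot w) ps j" if pj: "p \<le> j" for j
    proof
      assume r: "has_room (prepend_spot w) ps j"
      then obtain i where "j = Suc i" "1 \<le> i" "shift_pref p \<le> i"
        using dom[OF pj r] pj by (cases j) (auto simp: shift_pref_def)
      with None room r show False
        by (auto simp: next_spot_eq_None_iff)
    qed
    then have "next_spot (prepend_spot w) ps p = None"
      by (simp add: next_spot_eq_None_iff)
    with None show ?thesis by simp
  next
    case (Some i)
    have i: "1 \<le> i" "p \<le> Suc i" "has_room w qs i"
      using next_spot_SomeD[OF Some] by (auto simp: shift_pref_def)
    have "next_spot (prepend_spot w) ps p = Some (Suc i)"
    proof (rule next_spot_eq_Some)
      fix j assume j: "p \<le> j" "has_room (prepend_spot w) ps j"
      then obtain l where l: "j = Suc l" "1 \<le> l" "shift_pref p \<le> l"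
        using dom[OF j] j(1) by (cases j) (auto simp: shift_pref_def)
      then have "has_room w qs l" using j room by auto
      with Some l have "i \<le> l"
        by (auto simp: next_spot_def split: if_splits intro: Least_le)
      with l show "Suc i \<le> j" by simp
    qed (use i room in auto)
    with Some show ?thesis by simp
  qed
qed

lemma count_list_map_shift:
  "count_list (map (map_option Suc) qs) (Some (Suc j)) = count_list qs (Some j)"
  by (induction qs) (auto simp: map_option_case split: option.splits)

lemma parked_prepend_spot_no_first:
  assumes "\<forall>p\<in>set a. 2 \<le> p"
  shows "parked (prepend_spot w) a = map (map_option Suc) (parked w (map shift_pref a))"
  using assms
proof (induction a rule: rev_induct)
  case (snoc p a)
  then show ?case
    by (auto simp: parked_snoc count_list_map_shift intro!: next_spot_prepend_spot)
qed simp

text \<open>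
  The car after \<open>a1\<close> takes spot 1, which no earlier car wants; from then on spot 1 is full and the
  two processes run in parallel.
\<close>

lemma parked_prepend_spot:
  assumes w: "0 \<notin> set w" and a1: "\<forall>p\<in>set a1. 2 \<le> p" and a2: "\<forall>p\<in>set a2. 1 \<le> p"
  obtains q1 q2 where "length q1 = length a1" "length q2 = length a2"
    "parked w (map shift_pref (a1 @ a2)) = q1 @ q2"
    "parked (prepend_spot w) (a1 @ 1 # a2) =
       map (map_option Suc) q1 @ Some 1 # map (map_option Suc) q2"
proof -
  let ?S = "map_option Suc" and ?v = "prepend_spot w"
  define q1 where "q1 = parked w (map shift_pref a1)"
  have no_first: "count_list (map ?S q1) (Some 1) = 0"
  proof -
    have "Some 0 \<notin> set q1"
      using in_street_if_parked[of 0 w] w unfolding q1_def by metis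
    then show ?thesis
      by (auto simp: count_list_0_iff map_option_case split: option.splits)
  qed
  have "\<exists>q2. length q2 = length a2 \<and> parked w (map shift_pref (a1 @ a2)) = q1 @ q2 \<and>
      parked ?v (a1 @ 1 # a2) = map ?S q1 @ Some 1 # map ?S q2"
    using a2
  proof (induction a2 rule: rev_induct)
    case Nil
    have "next_spot ?v (map ?S q1) 1 = Some 1"
      using no_first w
      by (intro next_spot_eq_Some) (auto simp: has_room_def capacity_prepend_spot_1[simplified])
    then show ?case
      using parked_prepend_spot_no_first[OF a1, of w] parked_snoc[of ?v a1 1]
      by (simp add: q1_def)
  next
    case (snoc p a2)
    then obtain q2 where q2: "length q2 = length a2"
      "parked w (map shift_pref (a1 @ a2)) = q1 @ q2"
      "parked ?v (a1 @ 1 # a2) = map ?S q1 @ Some 1 # map ?S q2"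
      by auto
    let ?ps = "map ?S q1 @ Some 1 # map ?S q2"
    have "next_spot ?v ?ps p = ?S (next_spot w (q1 @ q2) (shift_pref p))"
    proof (rule next_spot_prepend_spot)
      show "\<not> has_room ?v ?ps 1"
        using w by (simp add: has_room_def capacity_prepend_spot_1[simplified])
    qed (use snoc.prems in \<open>auto simp: count_list_map_shift\<close>)
    then show ?case
      using q2 parked_snoc[of w "map shift_pref (a1 @ a2)" "shift_pref p"]
        parked_snoc[of ?v "a1 @ 1 # a2" p]
      by (intro exI[of _ "q2 @ [next_spot w (q1 @ q2) (shift_pref p)]"]) simp
  qed
  with that show ?thesis
    unfolding q1_def by (metis length_map length_parked)
qed

section \<open>Relabelling the cars\<close>

text \<open>
  Undoes the relabelling after the deletion of car \<open>c\<close>: the order isomorphism from the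
  positive numbers to the positive numbers without \<open>c\<close>.
\<close>

definition skip :: "nat \<Rightarrow> nat \<Rightarrow> nat" where
  "skip c y = (if y < c then y else Suc y)"

lemma inj_skip: "inj (skip c)"
  by (auto simp: inj_def skip_def split: if_splits)

lemma skip_neq: "skip c y \<noteq> c"
  by (simp add: skip_def)

lemma nth_skip:
  assumes "1 \<le> y"
  shows "(xs @ z # ys) ! (skip (Suc (length xs)) y - 1) = (xs @ ys) ! (y - 1)"
  using assms by (cases y) (auto simp: skip_def nth_append Suc_diff_le)

lemma atLeastAtMost_Suc_eq_insert_skip:
  assumes "1 \<le> c" "c \<le> Suc m"
  shows "{1..Suc m} = insert c (skip c ` {1..m})"
proof -
  have "x \<in> skip c ` {1..m}" if "x \<in> {1..Suc m}" "x \<noteq> c" for x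
    using that assms by (intro image_eqI[of _ _ "if x < c then x else x - 1"]) (auto simp: skip_def)
  moreover have "skip c y \<in> {1..Suc m}" if "y \<in> {1..m}" for y
    using that by (auto simp: skip_def)
  moreover have "c \<in> {1..Suc m}"
    using assms by simp
  ultimately show ?thesis by blast
qed

lemma Collect_skip:
  assumes "1 \<le> c" "c \<le> Suc m"
  shows "{x \<in> {1..Suc m}. P x} = {x. x = c \<and> P c} \<union> skip c ` {y \<in> {1..m}. P (skip c y)}"
  unfolding atLeastAtMost_Suc_eq_insert_skip[OF assms] by auto

lemma remove_relabel_insert_skip:
  assumes "1 \<le> c"
  shows "remove_relabel {c} (insert c (skip c ` L)) = L"
proof -
  have "skip c y - card ({c} \<inter> {1..skip c y}) = y" for y
    using assms by (auto simp: skip_def)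
  moreover have "insert c (skip c ` L) - {c} = skip c ` L"
    using skip_neq by auto
  ultimately show ?thesis
    by (simp add: remove_relabel_def image_image)
qed

lemma insert_skip_remove_relabel:
  assumes "1 \<le> c" "c \<in> I" "0 \<notin> I"
  shows "insert c (skip c ` remove_relabel {c} I) = I"
proof -
  have "skip c (x - card ({c} \<inter> {1..x})) = x" if "x \<noteq> c" "x \<in> I" for x
    using assms that by (cases "c \<le> x") (auto simp: skip_def)
  then have "skip c ` remove_relabel {c} I = I - {c}"
    by (force simp: remove_relabel_def image_image)
  with assms show ?thesis by auto
qed

section \<open>Outcomes and lucky sets\<close>

definition outcomes_with_lucky_set :: "nat list \<Rightarrow> nat set \<Rightarrow> nat set option list set" where
  "outcomes_with_lucky_set u I =
     {outcome u a | a. parking_function u a \<and> lucky_set u a = I}"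

definition insert_car :: "nat \<Rightarrow> nat set option list \<Rightarrow> nat set option list" where
  "insert_car c Bs = Some {c} # map (map_option (image (skip c))) Bs"

lemma inj_insert_car: "inj (insert_car c)"
proof -
  have "inj (map (map_option (image (skip c))))"
    by (intro inj_mapI option.inj_map inj_on_image_Pow[of _ UNIV, simplified] inj_skip)
  then show ?thesis
    by (auto simp: inj_def insert_car_def)
qed

lemma Max_prepend_spot:
  "Max (insert 0 (set (prepend_spot w))) = Suc (Max (insert 0 (set w)))"
proof -
  have "Max (insert 0 (set (prepend_spot w))) = Max (Suc ` insert 0 (set w))"
    unfolding prepend_spot_def by (cases "set w = {}") (auto simp: Max_insert)
  also have "\<dots> = Suc (Max (insert 0 (set w)))"
    by (rule mono_Max_commute[symmetric]) (auto simp: mono_def)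
  finally show ?thesis .
qed

text \<open>
  The passage from the longer street to the shorter one. Lucky sets correspond because the shorter
  street offers no spot 1: a car of \<open>a2\<close> that prefers spot 1 is unlucky on the longer street, and
  so is its counterpart, whose preference is again 1.
\<close>

lemma prepend_spot_correspondence:
  assumes w: "\<forall>x\<in>set w. 2 \<le> x" and a1: "\<forall>p\<in>set a1. 2 \<le> p" and a2: "\<forall>p\<in>set a2. 1 \<le> p"
  defines "a \<equiv> a1 @ 1 # a2" and "b \<equiv> map shift_pref (a1 @ a2)" and "c \<equiv> Suc (length a1)"
  shows "parking_function (prepend_spot w) a \<longleftrightarrow> parking_function w b" (is ?pf)
    and "outcome (prepend_spot w) a = insert_car c (outcome w b)" (is ?oc)
    and "lucky_set (prepend_spot w) a = insert c (skip c ` lucky_set w b)" (is ?lucky)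
proof -
  let ?v = "prepend_spot w"
  have w0: "0 \<notin> set w" using w by auto
  obtain q1 q2 where q: "length q1 = length a1" "length q2 = length a2" "parked w b = q1 @ q2"
    "parked ?v a = map (map_option Suc) q1 @ Some 1 # map (map_option Suc) q2"
    using parked_prepend_spot[OF w0 a1 a2] unfolding a_def b_def by blast
  define m where "m = length (a1 @ a2)"
  have len: "length a = Suc m" "length b = m" "1 \<le> c" "c \<le> Suc m"
    by (auto simp: a_def b_def c_def m_def)
  have at_c: "parked ?v a ! (c - 1) = Some 1" "a ! (c - 1) = 1"
    using q by (simp_all add: c_def a_def nth_append)
  have at_skip: "parked ?v a ! (skip c y - 1) = map_option Suc (parked w b ! (y - 1))"
      "b ! (y - 1) = shift_pref (a ! (skip c y - 1))" "1 \<le> a ! (skip c y - 1)"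
    if "y \<in> {1..m}" for y
  proof -
    have y: "1 \<le> y" "y - 1 < length (a1 @ a2)" using that by (auto simp: m_def)
    show "parked ?v a ! (skip c y - 1) = map_option Suc (parked w b ! (y - 1))"
      using nth_skip[OF y(1), of "map (map_option Suc) q1" "Some 1" "map (map_option Suc) q2"] q y
      by (simp add: c_def flip: map_append)
    have *: "a ! (skip c y - 1) = (a1 @ a2) ! (y - 1)"
      using nth_skip[OF y(1), of a1 1 a2] by (simp add: c_def a_def)
    show "b ! (y - 1) = shift_pref (a ! (skip c y - 1))"
      unfolding * b_def using y(2) by (rule nth_map)
    have "(a1 @ a2) ! (y - 1) \<in> set (a1 @ a2)" using y(2) by (rule nth_mem)
    then show "1 \<le> a ! (skip c y - 1)"
      unfolding * using a1 a2 by fastforce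
  qed
  have exists_spot: "2 \<le> j" if "y \<in> {1..m}" "parked w b ! (y - 1) = Some j" for y j
  proof -
    have "parked w b ! (y - 1) \<in> set (parked w b)"
      using that len by (intro nth_mem) auto
    with that w show ?thesis by (auto dest: in_street_if_parked)
  qed

  have "(\<forall>p\<in>set a. 1 \<le> p) \<and> (\<forall>p\<in>set b. 1 \<le> p)"
    using a1 a2 by (auto simp: a_def b_def shift_pref_def)
  moreover have "None \<in> set (parked ?v a) \<longleftrightarrow> None \<in> set (parked w b)"
    using q by force
  ultimately show ?pf
    using len by (auto simp: parking_function_def prepend_spot_def)

  have lucky_skip: "parked ?v a ! (skip c y - 1) = Some (a ! (skip c y - 1)) \<longleftrightarrow>
      parked w b ! (y - 1) = Some (b ! (y - 1))" if "y \<in> {1..m}" for y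
    using at_skip[OF that] exists_spot[OF that]
    by (cases "parked w b ! (y - 1)") (auto simp: shift_pref_def max_def)
  have "lucky_set ?v a =
      insert c (skip c ` {y \<in> {1..m}. parked ?v a ! (skip c y - 1) = Some (a ! (skip c y - 1))})"
    unfolding lucky_set_def len(1) Collect_skip[OF len(3,4)] using at_c by auto
  also have "{y \<in> {1..m}. parked ?v a ! (skip c y - 1) = Some (a ! (skip c y - 1))} =
      lucky_set w b"
    unfolding lucky_set_def len(2) using lucky_skip by blast
  finally show ?lucky .

  have cars_1: "{x \<in> {1..Suc m}. parked ?v a ! (x - 1) = Some 1} = {c}"
  proof -
    have "parked ?v a ! (skip c y - 1) \<noteq> Some 1" if "y \<in> {1..m}" for y
      using at_skip(1)[OF that] exists_spot[OF that] by fastforce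
    then show ?thesis
      unfolding Collect_skip[OF len(3,4)] using at_c by auto
  qed
  have cars_Suc: "{x \<in> {1..Suc m}. parked ?v a ! (x - 1) = Some (Suc j)} =
      skip c ` {y \<in> {1..m}. parked w b ! (y - 1) = Some j}" if "1 \<le> j" for j
  proof -
    have "parked ?v a ! (skip c y - 1) = Some (Suc j) \<longleftrightarrow> parked w b ! (y - 1) = Some j"
      if "y \<in> {1..m}" for y
      using at_skip(1)[OF that] by (cases "parked w b ! (y - 1)") auto
    then have "{y \<in> {1..m}. parked ?v a ! (skip c y - 1) = Some (Suc j)} =
        {y \<in> {1..m}. parked w b ! (y - 1) = Some j}"
      by blast
    then show ?thesis
      unfolding Collect_skip[OF len(3,4)] using at_c \<open>1 \<le> j\<close> by auto
  qed
  let ?M = "Max (insert 0 (set w))"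
  have "[1..<Suc (Suc ?M)] = 1 # map Suc [1..<Suc ?M]"
    by (subst upt_conv_Cons) (auto simp: map_Suc_upt)
  moreover define g where "g = (\<lambda>j. if 0 < capacity ?v j
      then Some {x \<in> {1..Suc m}. parked ?v a ! (x - 1) = Some j} else None)"
  ultimately have "outcome ?v a = g 1 # map (\<lambda>j. g (Suc j)) [1..<Suc ?M]"
    unfolding outcome_def Max_prepend_spot len by (simp del: upt_Suc add: comp_def)
  moreover have "g 1 = Some {c}"
    unfolding g_def cars_1 capacity_prepend_spot_1[OF w0] by simp
  moreover have "g (Suc j) = map_option (image (skip c))
      (if 0 < capacity w j then Some {y \<in> {1..m}. parked w b ! (y - 1) = Some j} else None)"
    if "1 \<le> j" for j
    unfolding g_def cars_Suc[OF that] capacity_prepend_spot_Suc[OF that] by simp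
  ultimately show ?oc
    unfolding outcome_def insert_car_def len by (simp del: upt_Suc)
qed

text \<open>
  If nobody preferred spot 1, it would stay empty and \<open>length w + 1\<close> cars would have to fit into
  the street \<open>w\<close>.
\<close>

lemma one_is_preferred:
  assumes pf: "parking_function (prepend_spot w) a"
  shows "1 \<in> set a"
proof (rule ccontr)
  assume "1 \<notin> set a"
  have "2 \<le> p" if "p \<in> set a" for p
  proof -
    have "1 \<le> p" "p \<noteq> 1"
      using that pf \<open>1 \<notin> set a\<close> by (auto simp: parking_function_def)
    then show ?thesis by simp
  qed
  then have "None \<notin> set (parked w (map shift_pref a))"
    using pf parked_prepend_spot_no_first[of a w] by (force simp: parking_function_def)
  then have "length a \<le> length w"
    using length_le_if_all_parked[of w "map shift_pref a"] by simp
  with pf show False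
    by (simp add: parking_function_def prepend_spot_def)
qed

text \<open>
  The car \<open>c\<close> that ends up in spot 1 is the first one with preference 1, and deleting it leads to
  the shorter street. Conversely, any \<open>c \<in> I\<close> can play this part: given preferences \<open>b\<close> on the
  shorter street, let \<open>c\<close> prefer spot 1 and move all other preferences up by one, so that nobody
  else prefers spot 1.
\<close>

lemma outcomes_prepend_spot:
  assumes w: "\<forall>x\<in>set w. 2 \<le> x" and I: "I \<subseteq> {1..Suc (length w)}"
  shows "outcomes_with_lucky_set (prepend_spot w) I =
    (\<Union>c\<in>I. insert_car c ` outcomes_with_lucky_set w (remove_relabel {c} I))"
    (is "?L = ?R")
proof (intro equalityI subsetI)
  fix Bs assume "Bs \<in> ?L"
  then obtain a where a: "Bs = outcome (prepend_spot w) a" "parking_function (prepend_spot w) a"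
    "lucky_set (prepend_spot w) a = I"
    by (auto simp: outcomes_with_lucky_set_def)
  obtain a1 a2 where s: "a = a1 @ 1 # a2" "1 \<notin> set a1"
    using one_is_preferred[OF a(2)] split_list_first by metis
  have pos: "\<forall>p\<in>set a. 1 \<le> p"
    using a(2) by (simp add: parking_function_def)
  have a1: "\<forall>p\<in>set a1. 2 \<le> p"
  proof
    fix p assume "p \<in> set a1"
    with s pos have "1 \<le> p" "p \<noteq> 1" by auto
    then show "2 \<le> p" by simp
  qed
  have a2: "\<forall>p\<in>set a2. 1 \<le> p" using pos s by simp
  let ?b = "map shift_pref (a1 @ a2)" and ?c = "Suc (length a1)"
  note corr = prepend_spot_correspondence[OF w a1 a2, folded s(1)]
  have I_eq: "I = insert ?c (skip ?c ` lucky_set w ?b)"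
    using corr(3) a(3) by simp
  then have "lucky_set w ?b = remove_relabel {?c} I"
    using remove_relabel_insert_skip[of ?c "lucky_set w ?b"] by simp
  then have "outcome w ?b \<in> outcomes_with_lucky_set w (remove_relabel {?c} I)"
    using corr(1) a(2) by (auto simp: outcomes_with_lucky_set_def)
  moreover have "?c \<in> I"
    using I_eq by blast
  ultimately show "Bs \<in> ?R"
    using corr(2) a(1) by auto
next
  fix Bs assume "Bs \<in> ?R"
  then obtain c b where c: "c \<in> I" and b: "Bs = insert_car c (outcome w b)" "parking_function w b"
    "lucky_set w b = remove_relabel {c} I"
    by (auto simp: outcomes_with_lucky_set_def)
  define a1 a2 where "a1 = map Suc (take (c - 1) b)" and "a2 = map Suc (drop (c - 1) b)"
  have pos: "\<forall>p\<in>set b. 1 \<le> p" and len: "length b = length w"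
    using b(2) by (simp_all add: parking_function_def)
  have a1: "\<forall>p\<in>set a1. 2 \<le> p" and a2: "\<forall>p\<in>set a2. 1 \<le> p"
    using pos by (auto simp: a1_def a2_def dest: in_set_takeD)
  have c_eq: "Suc (length a1) = c"
  proof -
    have "1 \<le> c" "c \<le> Suc (length w)"
      using c I by auto
    then show ?thesis
      using len by (simp add: a1_def)
  qed
  have "a1 @ a2 = map Suc b"
    by (simp add: a1_def a2_def flip: map_append)
  then have b_eq: "map shift_pref (a1 @ a2) = b"
    using pos by (simp add: map_idI shift_pref_def max_def)
  note corr = prepend_spot_correspondence[OF w a1 a2, unfolded b_eq c_eq]
  have "insert c (skip c ` remove_relabel {c} I) = I"
    using c I by (intro insert_skip_remove_relabel) auto
  then show "Bs \<in> ?L"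
    using corr b unfolding outcomes_with_lucky_set_def
    by (intro CollectI exI[of _ "a1 @ 1 # a2"]) simp
qed

lemma finite_outcomes_with_lucky_set: "finite (outcomes_with_lucky_set u I)"
proof -
  let ?E = "insert None (Some ` Pow {1..length u})"
  let ?m = "Max (insert 0 (set u))"
  have "set (outcome u a) \<subseteq> ?E \<and> length (outcome u a) = ?m" if "length a = length u" for a
  proof
    have "{c \<in> {1..length u}. P c} \<in> Pow {1..length u}" for P
      by blast
    then show "set (outcome u a) \<subseteq> ?E"
      unfolding outcome_def that set_map by (intro image_subsetI) (simp split: if_split)
    show "length (outcome u a) = ?m"
      by (simp add: outcome_def del: upt_Suc)
  qed
  then have "outcomes_with_lucky_set u I \<subseteq> {Bs. set Bs \<subseteq> ?E \<and> length Bs = ?m}"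
    unfolding outcomes_with_lucky_set_def parking_function_def by blast
  moreover have "finite {Bs. set Bs \<subseteq> ?E \<and> length Bs = ?m}"
    by (rule finite_lists_length_eq) simp
  ultimately show ?thesis
    by (rule finite_subset)
qed

theorem theorem3p16:
  fixes n k :: nat and i :: "nat \<Rightarrow> nat" and I :: "nat set"
  assumes "1 \<le> n"
    and "strict_mono_on {1..k} i"
    and "I = i ` {1..k}"
    and "I \<subseteq> {1..n}"
  shows "num_outcomes 2 n I = (\<Sum>j=1..k. num_outcomes 1 (n - 1) (remove_relabel {i j} I))"
proof -
  let ?w = "street_without 1 (n - 1)"
  let ?O = "\<lambda>c. outcomes_with_lucky_set ?w (remove_relabel {c} I)"
  have num: "num_outcomes s m J = card (outcomes_with_lucky_set (street_without s m) J)" for s m J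
    by (simp add: num_outcomes_def outcomes_with_lucky_set_def)
  have w: "\<forall>x\<in>set ?w. 2 \<le> x" "Suc (length ?w) = n"
    using \<open>1 \<le> n\<close> by (auto simp: street_without_def)
  have street: "street_without 2 n = prepend_spot ?w"
    using \<open>1 \<le> n\<close> by (simp add: street_without_def prepend_spot_def map_Suc_upt del: upt_Suc)
      (simp add: eval_nat_numeral)
  have "outcomes_with_lucky_set (street_without 2 n) I = (\<Union>c\<in>I. insert_car c ` ?O c)"
    unfolding street using w \<open>I \<subseteq> {1..n}\<close> by (intro outcomes_prepend_spot) auto
  then have "num_outcomes 2 n I = card (\<Union>c\<in>I. insert_car c ` ?O c)"
    by (simp add: num)
  also have "\<dots> = (\<Sum>c\<in>I. card (insert_car c ` ?O c))"
    using \<open>I = i ` {1..k}\<close>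
    by (subst card_UN_disjoint) (auto simp: finite_outcomes_with_lucky_set insert_car_def)
  also have "\<dots> = (\<Sum>c\<in>I. num_outcomes 1 (n - 1) (remove_relabel {c} I))"
    by (simp add: num card_image inj_on_subset[OF inj_insert_car])
  also have "\<dots> = (\<Sum>j=1..k. num_outcomes 1 (n - 1) (remove_relabel {i j} I))"
    using strict_mono_on_imp_inj_on[OF assms(2)] unfolding \<open>I = i ` {1..k}\<close>
    by (simp add: sum.reindex)
  finally show ?thesis .
qed

end
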